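(* Let $h=\sum_{i=0}^{N}c_ix^i\in \Bbbk[x]$ with $\deg(h)=N\geq 1$, $c_N=1$ and $c_{N-1}=0$, and let $\mathcal{S}_h=\{i \mid c_i\neq 0\}$. Then: (i) if $h(x)=x^N$, then $\operatorname{Aut}(A_h)=\Bbbk[x]\rtimes \Bbbk^{\ast}$; (ii) otherwise, writing $\mathcal{S}_h=\{i_1,i_2,\dots,i_k,N\}$ (with $i_1,\dots,i_k$ the elements of $\mathcal{S}_h$ different from $N$), one has $$\operatorname{Aut}(A_h)=\Bbbk[x]\rtimes\Big(\bigcap_{i\in\mathcal{S}_h}\mathbb{G}_{N-i}\Big)=\Bbbk[x]\rtimes \mathbb{G}_{\gcd(N-i_1,\,N-i_2,\,\dots,\,N-i_k)}.$$
   Context: $\Bbbk$ is an algebraically closed field of characteristic zero. For $h\in\Bbbk[x]$ nonzero, $A_h=\Bbbk[x][t;d]$, $d=h(x)\partial_x$, is the associative unital $\Bbbk$-algebra generated by $x,t$ subject to $tx=xt+h(x)$. $\operatorname{Aut}(A_h)$ is the group of $\Bbbk$-algebra automorphisms. For $n\ge 1$, $\mathbb{G}_n=\{a\in\Bbbk\mid a^n=1\}$, and $\mathbb{G}_0=\Bbbk^{\ast}$. For $r(x)\in\Bbbk[x]$, $\sigma_{r(x)}$ is the automorphism with $\sigma_{r(x)}(x)=x$, $\sigma_{r(x)}(t)=t+r(x)$; for $a\in\Bbbk^\ast$ with $h(ax)=a^Nh(x)$, $N=\deg h$, $\tau_a$ is the automorphism with $\tau_a(x)=ax$, $\tau_a(t)=a^{N-1}t$.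 For a subgroup $G\subseteq\Bbbk^\ast$, the equality $\operatorname{Aut}(A_h)=\Bbbk[x]\rtimes G$ means: $\tau_a$ is defined exactly for $a\in G$ (i.e. $\{a\in\Bbbk^\ast\mid h(ax)=a^Nh(x)\}=G$), and $\operatorname{Aut}(A_h)$ is the (internal) semidirect product of the normal subgroup $\{\sigma_{r(x)}\mid r(x)\in\Bbbk[x]\}$ (identified with the additive group $\Bbbk[x]$) and the subgroup $\{\tau_a\mid a\in G\}$ (identified with $G$), so that every automorphism is uniquely $\sigma_{r(x)}\circ\tau_a$ with $r(x)\in\Bbbk[x]$, $a\in G$. *)

theory Defs
  imports
    "HOL-Algebra.QuotRing"
    "HOL-Computational_Algebra.Polynomial"
begin

section \<open>The Ore extension \<open>k[x][t; h d/dx]\<close>\<close>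

text \<open>
  An element \<open>p\<^sub>0(x) + p\<^sub>1(x) t + \<dots> + p\<^sub>n(x) t\<^sup>n\<close> (coefficients written on the left of the powers
  of \<open>t\<close>) is represented by its list of coefficients, an element of \<open>'a poly poly\<close>. The type's own
  multiplication is not the one used; only its addition and its left \<open>k[x]\<close>-module
  structure \<^const>\<open>smult\<close> are.
  The relation \<open>t q = q t + h q'\<close> gives left multiplication by \<open>t\<close>, and iterating it gives the product.
\<close>

definition ore_t_mult :: "'a::field poly \<Rightarrow> 'a poly poly \<Rightarrow> 'a poly poly" where
  "ore_t_mult h Q = pCons 0 Q + map_poly (\<lambda>q. h * pderiv q) Q"

definition ore_mult :: "'a::field poly \<Rightarrow> 'a poly poly \<Rightarrow> 'a poly poly \<Rightarrow> 'a poly poly" where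
  "ore_mult h P Q = (\<Sum>i\<le>degree P. smult (coeff P i) ((ore_t_mult h ^^ i) Q))"

definition ore_ext :: "'a::field poly \<Rightarrow> 'a poly poly ring" where
  "ore_ext h = \<lparr>carrier = UNIV, monoid.mult = ore_mult h, one = 1, ring.zero = 0, add = (+)\<rparr>"

definition ore_x :: "'a::field poly poly" where "ore_x = [:[:0, 1:]:]"

definition ore_t :: "'a::field poly poly" where "ore_t = [:0, 1:]"

text \<open>The scalar \<open>c \<in> k\<close> acts as \<open>smult [:c:]\<close>.\<close>

definition ore_aut :: "'a::field poly \<Rightarrow> ('a poly poly \<Rightarrow> 'a poly poly) monoid" where
  "ore_aut h =
    \<lparr>carrier = {f \<in> ring_iso (ore_ext h) (ore_ext h). \<forall>c P. f (smult [:c:] P) = smult [:c:] (f P)},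
     monoid.mult = (\<circ>), one = id\<rparr>"

text \<open>Existence and uniqueness of these automorphisms are proved below
  (\<open>ore_sigma_ex1\<close>, \<open>ore_tau_ex1\<close>).\<close>

definition ore_sigma :: "'a::field poly \<Rightarrow> 'a poly \<Rightarrow> 'a poly poly \<Rightarrow> 'a poly poly" where
  "ore_sigma h r = (THE f. f \<in> carrier (ore_aut h) \<and> f ore_x = ore_x \<and> f ore_t = ore_t + [:r:])"

definition ore_tau :: "'a::field poly \<Rightarrow> 'a \<Rightarrow> 'a poly poly \<Rightarrow> 'a poly poly" where
  "ore_tau h a = (THE f. f \<in> carrier (ore_aut h) \<and> f ore_x = smult [:a:] ore_x \<and>
     f ore_t = smult [:a powi (int (degree h) - 1):] ore_t)"


section \<open>Semidirect products\<close>

definition add_group_of :: "'b::ab_group_add itself \<Rightarrow> 'b monoid" where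
  "add_group_of _ = \<lparr>carrier = UNIV, monoid.mult = (+), one = 0\<rparr>"

definition mult_group_of :: "'b::field itself \<Rightarrow> 'b monoid" where
  "mult_group_of _ = \<lparr>carrier = {a. a \<noteq> 0}, monoid.mult = (*), one = 1\<rparr>"

definition internal_semidirect :: "('b, 'c) monoid_scheme \<Rightarrow> 'b set \<Rightarrow> 'b set \<Rightarrow> bool" where
  "internal_semidirect A N H \<longleftrightarrow>
     N \<lhd> A \<and> subgroup H A \<and> N \<inter> H = {\<one>\<^bsub>A\<^esub>} \<and> N <#>\<^bsub>A\<^esub> H = carrier A"

definition tau_domain :: "'a::field poly \<Rightarrow> 'a set" where
  "tau_domain h = {a. a \<noteq> 0 \<and> pcompose h [:0, a:] = smult (a ^ degree h) h}"

definition aut_eq_semidirect :: "'a::field poly \<Rightarrow> 'a set \<Rightarrow> bool" where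
  "aut_eq_semidirect h G \<longleftrightarrow>
     subgroup G (mult_group_of TYPE('a)) \<and>
     tau_domain h = G \<and>
     internal_semidirect (ore_aut h) (range (ore_sigma h)) (ore_tau h ` G) \<and>
     ore_sigma h \<in> iso (add_group_of TYPE('a poly)) (ore_aut h\<lparr>carrier := range (ore_sigma h)\<rparr>) \<and>
     ore_tau h \<in> iso (mult_group_of TYPE('a)\<lparr>carrier := G\<rparr>) (ore_aut h\<lparr>carrier := ore_tau h ` G\<rparr>) \<and>
     bij_betw (\<lambda>(r, a). ore_sigma h r \<circ> ore_tau h a) (UNIV \<times> G) (carrier (ore_aut h))"

definition root_group :: "nat \<Rightarrow> 'a::field set" where
  "root_group n = (if n = 0 then {a. a \<noteq> 0} else {a. a ^ n = 1})"

definition poly_support :: "'a::zero poly \<Rightarrow> nat set" where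
  "poly_support h = {i. coeff h i \<noteq> 0}"


section \<open>The ring axioms\<close>

lemma coeff_ore_t_mult:
  "coeff (ore_t_mult h Q) n = coeff (pCons 0 Q) n + h * pderiv (coeff Q n)"
  by (simp add: ore_t_mult_def coeff_map_poly)

lemma ore_t_mult_0 [simp]: "ore_t_mult h 0 = 0"
  by (simp add: ore_t_mult_def)

lemma ore_t_mult_add: "ore_t_mult h (P + Q) = ore_t_mult h P + ore_t_mult h Q"
  by (rule poly_eqI) (auto simp: coeff_ore_t_mult coeff_pCons pderiv_add algebra_simps split: nat.split)

lemma ore_t_mult_smult:
  "ore_t_mult h (smult p Q) = smult p (ore_t_mult h Q) + smult (h * pderiv p) Q"
  by (rule poly_eqI) (auto simp: coeff_ore_t_mult coeff_pCons pderiv_mult algebra_simps split: nat.split)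

lemma ore_t_mult_pCons:
  "ore_t_mult h (pCons p P) = pCons (h * pderiv p) ([:p:] + ore_t_mult h P)"
  by (rule poly_eqI) (auto simp: coeff_ore_t_mult coeff_pCons split: nat.split)

lemma ore_t_mult_monom: "ore_t_mult h (monom 1 n) = monom 1 (Suc n)"
  by (rule poly_eqI) (auto simp: coeff_ore_t_mult coeff_pCons split: nat.split)

lemma ore_smult_one [simp]: "smult [:1:] (Q :: 'a::field poly poly) = Q"
  by (simp flip: one_pCons)

lemma ore_mult_0 [simp]: "ore_mult h 0 Q = 0"
  by (simp add: ore_mult_def)

lemma ore_mult_pCons: "ore_mult h (pCons p P) Q = smult p Q + ore_mult h P (ore_t_mult h Q)"
  by (cases "P = 0") (simp_all add: ore_mult_def sum.atMost_Suc_shift funpow_swap1 del: sum.atMost_Suc)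

lemma ore_mult_add_right: "ore_mult h P (Q + R) = ore_mult h P Q + ore_mult h P R"
  by (induction P arbitrary: Q R) (simp_all add: ore_mult_pCons ore_t_mult_add smult_add_right)

lemma ore_mult_0_right [simp]: "ore_mult h P 0 = 0"
  by (induction P) (simp_all add: ore_mult_pCons)

lemma ore_mult_add_left: "ore_mult h (P + Q) R = ore_mult h P R + ore_mult h Q R"
  by (induction P Q arbitrary: R rule: poly_induct2) (simp_all add: ore_mult_pCons smult_add_left)

lemma ore_mult_smult_left: "ore_mult h (smult p P) Q = smult p (ore_mult h P Q)"
  by (induction P arbitrary: Q) (simp_all add: ore_mult_pCons smult_add_right)

lemma ore_mult_t_mult: "ore_mult h (ore_t_mult h P) Q = ore_t_mult h (ore_mult h P Q)"
  by (induction P arbitrary: Q)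
    (simp_all add: ore_mult_pCons ore_t_mult_pCons ore_mult_add_left ore_t_mult_add ore_t_mult_smult)

lemma ore_mult_assoc: "ore_mult h (ore_mult h P Q) R = ore_mult h P (ore_mult h Q R)"
  by (induction P arbitrary: Q)
    (simp_all add: ore_mult_pCons ore_mult_add_left ore_mult_smult_left ore_mult_t_mult)

lemma ore_mult_const: "ore_mult h [:p:] Q = smult p Q"
  by (simp add: ore_mult_pCons)

lemma ore_mult_one_left: "ore_mult h 1 Q = Q"
  by (simp add: one_pCons ore_mult_const)

lemma ore_mult_monom: "ore_mult h P (monom 1 n) = P * monom 1 n"
proof (induction P arbitrary: n)
  case (pCons p P)
  have "ore_mult h P (monom 1 (Suc n)) = pCons 0 (P * monom 1 n)"
    by (subst pCons.IH) (simp add: monom_Suc)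
  then show ?case
    by (simp add: ore_mult_pCons ore_t_mult_monom)
qed simp

lemma ore_mult_one_right: "ore_mult h P 1 = P"
  using ore_mult_monom[of h P 0] by (simp flip: one_pCons)

lemma ore_mult_t_right: "ore_mult h P ore_t = pCons 0 P"
  using ore_mult_monom[of h P 1] by (simp add: ore_t_def monom_altdef)

lemma ring_ore_ext: "ring (ore_ext h)"
proof (rule ringI)
  show "abelian_group (ore_ext h)"
  proof (rule abelian_groupI)
    fix P assume "P \<in> carrier (ore_ext h)"
    show "\<exists>Q\<in>carrier (ore_ext h). Q \<oplus>\<^bsub>ore_ext h\<^esub> P = \<zero>\<^bsub>ore_ext h\<^esub>"
      by (rule bexI[of _ "- P"]) (simp_all add: ore_ext_def)
  qed (simp_all add: ore_ext_def algebra_simps)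
  show "Group.monoid (ore_ext h)"
    by (rule monoidI)
      (simp_all add: ore_ext_def ore_mult_assoc ore_mult_one_left ore_mult_one_right)
qed (simp_all add: ore_ext_def ore_mult_add_left ore_mult_add_right)

lemma ore_relation:
  "ore_t \<otimes>\<^bsub>ore_ext h\<^esub> ore_x = ore_x \<otimes>\<^bsub>ore_ext h\<^esub> ore_t \<oplus>\<^bsub>ore_ext h\<^esub> [:h:]"
  by (simp add: ore_ext_def ore_mult_t_right ore_x_def ore_t_def ore_mult_pCons
      ore_t_mult_pCons pderiv_pCons)


section \<open>Existence and uniqueness of the distinguished automorphisms\<close>

lemma ore_aut_iff:
  "f \<in> carrier (ore_aut h) \<longleftrightarrow>
     bij f \<and> f 1 = 1 \<and> (\<forall>P Q. f (P + Q) = f P + f Q) \<and>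
     (\<forall>P Q. f (ore_mult h P Q) = ore_mult h (f P) (f Q)) \<and>
     (\<forall>c P. f (smult [:c:] P) = smult [:c:] (f P))"
  by (auto simp: ore_aut_def ore_ext_def ring_iso_def ring_hom_def)

text \<open>The algebra is generated by \<open>x\<close> and \<open>t\<close>.\<close>

lemma ore_hom_eqI:
  assumes f: "f 1 = 1" "\<And>P Q. f (P + Q) = f P + f Q"
      "\<And>P Q. f (ore_mult h P Q) = ore_mult h (f P) (f Q)"
      "\<And>c P. f (smult [:c:] P) = smult [:c:] (f P)"
    and g: "g 1 = 1" "\<And>P Q. g (P + Q) = g P + g Q"
      "\<And>P Q. g (ore_mult h P Q) = ore_mult h (g P) (g Q)"
      "\<And>c P. g (smult [:c:] P) = smult [:c:] (g P)"
    and xt: "f ore_x = g ore_x" "f ore_t = g ore_t"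
  shows "f = g"
proof
  have 0: "f 0 = 0" "g 0 = 0"
    using f(4)[of 0 0] g(4)[of 0 0] by simp_all
  have c: "f [:c:] = g [:c:]" for c
  proof (induction c)
    case (pCons a c)
    have *: "[:pCons a c:] = smult [:a:] 1 + ore_mult h ore_x [:c:]"
      by (simp add: ore_x_def ore_mult_const one_pCons)
    show ?case
      unfolding * by (simp only: f g xt pCons)
  qed (simp add: 0)
  show "f P = g P" for P
  proof (induction P)
    case (pCons p P)
    have *: "pCons p P = [:p:] + ore_mult h P ore_t"
      by (simp add: ore_mult_t_right)
    show ?case
      unfolding * by (simp only: f g xt pCons c)
  qed (simp add: 0)
qed

text \<open>The substitution \<open>x \<mapsto> a x\<close>, \<open>t \<mapsto> s t + r(x)\<close>.\<close>

definition ore_subst :: "'a::field poly \<Rightarrow> 'a \<Rightarrow> 'a \<Rightarrow> 'a poly \<Rightarrow> 'a poly poly \<Rightarrow> 'a poly poly" where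
  "ore_subst h a s r P =
     fold_coeffs (\<lambda>p R. [:pcompose p [:0, a:]:] + ore_mult h R [:r, [:s:]:]) P 0"

lemma ore_subst_0 [simp]: "ore_subst h a s r 0 = 0"
  by (simp add: ore_subst_def)

lemma ore_subst_pCons:
  "ore_subst h a s r (pCons p P) =
     [:pcompose p [:0, a:]:] + ore_mult h (ore_subst h a s r P) [:r, [:s:]:]"
  by (cases "p = 0 \<and> P = 0") (auto simp: ore_subst_def)

lemma ore_subst_const: "ore_subst h a s r [:p:] = [:pcompose p [:0, a:]:]"
  by (simp add: ore_subst_pCons)

lemma ore_subst_add: "ore_subst h a s r (P + Q) = ore_subst h a s r P + ore_subst h a s r Q"
  by (induction P Q rule: poly_induct2)
    (simp_all add: ore_subst_pCons ore_mult_add_left pcompose_add)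

lemma ore_subst_smult:
  "ore_subst h a s r (smult p P) = smult (pcompose p [:0, a:]) (ore_subst h a s r P)"
  by (induction P)
    (simp_all add: ore_subst_pCons ore_mult_smult_left pcompose_mult smult_add_right)

lemma ore_subst_t_mult:
  assumes h: "pcompose h [:0, a:] = smult (s * a) h"
  shows "ore_subst h a s r (ore_t_mult h P) = ore_mult h [:r, [:s:]:] (ore_subst h a s r P)"
proof (induction P)
  case (pCons p P)
  have "ore_mult h [:r, [:s:]:] [:pcompose p [:0, a:]:] =
      smult (pcompose p [:0, a:]) [:r, [:s:]:] + [:pcompose (h * pderiv p) [:0, a:]:]"
    by (simp add: ore_mult_pCons ore_t_mult_pCons pderiv_pcompose pcompose_mult h
        pderiv_pCons algebra_simps)
  with pCons show ?case
    by (simp add: ore_t_mult_pCons ore_subst_pCons ore_subst_add ore_mult_add_left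
        ore_mult_add_right ore_mult_const ore_mult_assoc algebra_simps)
qed simp

lemma ore_subst_mult:
  assumes h: "pcompose h [:0, a:] = smult (s * a) h"
  shows "ore_subst h a s r (ore_mult h P Q) = ore_mult h (ore_subst h a s r P) (ore_subst h a s r Q)"
  by (induction P arbitrary: Q)
    (simp_all add: ore_mult_pCons ore_subst_pCons ore_subst_add ore_subst_smult
      ore_subst_t_mult[OF h] ore_mult_add_left ore_mult_assoc)

lemma ore_subst_one: "ore_subst h a s r 1 = 1"
  by (simp add: one_pCons ore_subst_const pcompose_pCons)

lemma ore_subst_scalar: "ore_subst h a s r (smult [:c:] P) = smult [:c:] (ore_subst h a s r P)"
  by (simp add: ore_subst_smult pcompose_pCons)

lemma ore_subst_x: "ore_subst h a s r ore_x = smult [:a:] ore_x"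
  by (simp add: ore_x_def ore_subst_const pcompose_pCons)

lemma ore_subst_t: "ore_subst h a s r ore_t = smult [:s:] ore_t + [:r:]"
  by (simp add: ore_t_def ore_subst_pCons ore_subst_one ore_mult_one_left flip: one_pCons)

lemma ore_subst_inverse:
  assumes nz: "a * a' = 1" "s * s' = 1"
    and h: "pcompose h [:0, a:] = smult (s * a) h" and h': "pcompose h [:0, a':] = smult (s' * a') h"
    and r: "pcompose r [:0, a':] + smult s r' = 0"
  shows "ore_subst h a' s' r' \<circ> ore_subst h a s r = id"
proof (rule ore_hom_eqI[where h = h])
  show "(ore_subst h a' s' r' \<circ> ore_subst h a s r) ore_x = id ore_x"
    using nz by (simp add: ore_subst_x ore_subst_scalar mult.commute)
  have "[:pcompose r [:0, a':] + smult s r':] = 0"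
    using r by simp
  then show "(ore_subst h a' s' r' \<circ> ore_subst h a s r) ore_t = id ore_t"
    using nz by (simp add: ore_subst_t ore_subst_scalar ore_subst_add ore_subst_const
        smult_add_right algebra_simps)
qed (simp_all add: ore_subst_one ore_subst_add ore_subst_mult[OF h] ore_subst_mult[OF h']
    ore_subst_scalar)

lemma ore_subst_aut:
  assumes a: "a \<noteq> 0" and s: "s \<noteq> 0" and h: "pcompose h [:0, a:] = smult (s * a) h"
  shows "ore_subst h a s r \<in> carrier (ore_aut h)"
proof -
  define a' s' r' where "a' = inverse a" and "s' = inverse s"
    and "r' = smult (- s') (pcompose r [:0, a':])"
  have inv: "a * a' = 1" "s * s' = 1" "a' * a = 1" "s' * s = 1"
    using a s by (simp_all add: a'_def s'_def)
  have comp: "pcompose (pcompose p [:0, a:]) [:0, a':] = p"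
    "pcompose (pcompose p [:0, a':]) [:0, a:] = p" for p
    using inv by (simp_all add: pcompose_assoc[symmetric] pcompose_pCons)
  have "h = smult (s * a) (pcompose h [:0, a':])"
    using arg_cong[OF h, of "\<lambda>p. pcompose p [:0, a':]"] by (simp add: comp pcompose_smult)
  then have "smult (s' * a') h = smult ((s' * a') * (s * a)) (pcompose h [:0, a':])"
    by (metis smult_smult)
  also have "(s' * a') * (s * a) = 1"
    using inv by (metis mult.assoc mult.commute mult.left_neutral)
  finally have h': "pcompose h [:0, a':] = smult (s' * a') h"
    by simp
  have "ore_subst h a' s' r' \<circ> ore_subst h a s r = id"
    by (rule ore_subst_inverse) (use inv h h' in \<open>simp_all add: r'_def\<close>)
  moreover have "ore_subst h a s r \<circ> ore_subst h a' s' r' = id"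
    by (rule ore_subst_inverse) (use inv h h' in \<open>simp_all add: r'_def comp pcompose_smult pcompose_uminus\<close>)
  ultimately have "bij (ore_subst h a s r)"
    by (rule o_bij)
  then show ?thesis
    by (simp add: ore_aut_iff ore_subst_one ore_subst_add ore_subst_mult[OF h] ore_subst_scalar)
qed

lemma ore_aut_eqI:
  assumes "f \<in> carrier (ore_aut h)" "g \<in> carrier (ore_aut h)" "f ore_x = g ore_x" "f ore_t = g ore_t"
  shows "f = g"
  by (rule ore_hom_eqI[where h = h]) (use assms in \<open>simp_all add: ore_aut_iff\<close>)

lemma ore_sigma_ex1:
  "\<exists>!f. f \<in> carrier (ore_aut h) \<and> f ore_x = ore_x \<and> f ore_t = ore_t + [:r:]"
proof (rule ex_ex1I)
  have "ore_subst h 1 1 r \<in> carrier (ore_aut h)"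
    by (rule ore_subst_aut) simp_all
  then show "\<exists>f. f \<in> carrier (ore_aut h) \<and> f ore_x = ore_x \<and> f ore_t = ore_t + [:r:]"
    by (intro exI[of _ "ore_subst h 1 1 r"]) (simp add: ore_subst_x ore_subst_t flip: one_pCons)
qed (metis ore_aut_eqI)

lemma ore_tau_ex1:
  assumes "a \<in> tau_domain h"
  shows "\<exists>!f. f \<in> carrier (ore_aut h) \<and> f ore_x = smult [:a:] ore_x \<and>
     f ore_t = smult [:a powi (int (degree h) - 1):] ore_t"
proof (rule ex_ex1I)
  define s where "s = a powi (int (degree h) - 1)"
  have a: "a \<noteq> 0" and h: "pcompose h [:0, a:] = smult (a ^ degree h) h"
    using assms by (simp_all add: tau_domain_def)
  have "s * a = a ^ degree h"
    using a by (simp add: s_def power_int_diff)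
  then have "ore_subst h a s 0 \<in> carrier (ore_aut h)"
    using a h by (intro ore_subst_aut) (auto simp: s_def)
  then show "\<exists>f. f \<in> carrier (ore_aut h) \<and> f ore_x = smult [:a:] ore_x \<and>
      f ore_t = smult [:a powi (int (degree h) - 1):] ore_t"
    unfolding s_def[symmetric]
    by (intro exI[of _ "ore_subst h a s 0"]) (simp add: ore_subst_x ore_subst_t)
qed (metis ore_aut_eqI)

end

theory Submission
  imports Defs
begin

text \<open>
  The commutator ideal of \<open>A\<^sub>h\<close> is \<open>h A\<^sub>h\<close>, and it is stable under automorphisms, so
  an automorphism \<open>f\<close> multiplies \<open>h\<close> by a unit. The degree in \<open>t\<close> is additive on products, so
  \<open>deg f(h) = N deg f(x)\<close> must vanish. Hence \<open>f\<close> restricts to an automorphism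
  \<open>x \<mapsto> a x + b\<close> of \<open>k[x]\<close>, surjectivity makes \<open>f(t) = s t + r(x)\<close>, and the defining relation becomes
  \<open>h(a x + b) = a s h(x)\<close>. Comparing degrees and leading coefficients, \<open>s = a\<^bsup>N-1\<^esup>\<close>; the coefficients
  of \<open>x\<^bsup>N-1\<^esup>\<close> give \<open>b = 0\<close>. What remains is the condition \<open>h(a x) = a\<^sup>N h(x)\<close>, i.e. \<open>a\<^bsup>N-i\<^esup> = 1\<close> for
  every \<open>i\<close> in the support of \<open>h\<close>.
\<close>

section \<open>Degrees and commutators\<close>

text \<open>The derivation term acts coefficientwise and cannot raise the degree in t, so the
  shifted term \<open>pCons 0 Q\<close> dominates.\<close>

lemma ore_t_mult_degree:
  assumes "Q \<noteq> 0"
  shows "degree (ore_t_mult h Q) = Suc (degree Q)"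
proof -
  have "degree (map_poly (\<lambda>q. h * pderiv q) Q) < degree (pCons 0 Q)"
    using assms by (simp add: map_poly_degree_leq less_Suc_eq_le)
  then show ?thesis
    using assms by (simp add: ore_t_mult_def degree_add_eq_left)
qed

text \<open>Induction peels off the t-free coefficient of \<open>P\<close>: writing the left factor
  as p + P t, the product is p Q + P (t Q). When P is nonzero, the second summand has strictly
  larger degree, so nothing cancels at the top. In particular there are no zero divisors.\<close>

lemma ore_mult_degree:
  assumes "P \<noteq> 0" "Q \<noteq> 0"
  shows "ore_mult h P Q \<noteq> 0 \<and> degree (ore_mult h P Q) = degree P + degree Q"
  using assms
proof (induction P arbitrary: Q)
  case (pCons p P)
  show ?case
  proof (cases "P = 0")
    case True
    with pCons show ?thesis by (auto simp: ore_mult_pCons)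
  next
    case False
    have "ore_t_mult h Q \<noteq> 0"
      using ore_t_mult_degree[OF \<open>Q \<noteq> 0\<close>, of h] by auto
    from pCons.IH[OF False this]
    have deg: "degree (ore_mult h P (ore_t_mult h Q)) = degree P + Suc (degree Q)"
      by (simp add: ore_t_mult_degree[OF \<open>Q \<noteq> 0\<close>])
    have "degree (smult p Q) < degree (ore_mult h P (ore_t_mult h Q))"
      unfolding deg using degree_smult_le[of p Q] by simp
    then have "degree (ore_mult h (pCons p P) Q) = degree P + Suc (degree Q)"
      by (simp add: ore_mult_pCons degree_add_eq_right deg)
    with False show ?thesis by auto
  qed
qed simp

text \<open>Here \<open>*\<close> and \<open>dvd\<close> belong to the commutative ring k[x][t]. The
  two products differ only through the derivation terms, and each of these carries a factor
  \<open>h\<close>.\<close>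

lemma dvd_ore_mult_diff: "[:h:] dvd ore_mult h P Q - P * Q"
proof (induction P arbitrary: Q)
  case (pCons p P)
  have "[:h:] dvd ore_t_mult h Q - pCons 0 Q"
    by (auto simp: const_poly_dvd_iff ore_t_mult_def coeff_map_poly)
  \<comment> \<open>The difference for \<open>pCons p P\<close> telescopes through the mixed term
    \<open>P * ore_t_mult h Q\<close>.\<close>
  then have "[:h:] dvd (ore_mult h P (ore_t_mult h Q) - P * ore_t_mult h Q) +
      P * (ore_t_mult h Q - pCons 0 Q)"
    using pCons.IH by (intro dvd_add dvd_mult) auto
  also have "\<dots> = ore_mult h (pCons p P) Q - pCons p P * Q"
    by (simp add: ore_mult_pCons algebra_simps)
  finally show ?case .
qed simp

text \<open>Modulo \<open>h\<close> the algebra is the commutative ring \<open>(k[x]/h)[t]\<close>.\<close>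

lemma dvd_ore_commutator: "[:h:] dvd ore_mult h P Q - ore_mult h Q P"
proof -
  have "[:h:] dvd (ore_mult h P Q - P * Q) - (ore_mult h Q P - Q * P)"
    by (intro dvd_diff dvd_ore_mult_diff)
  then show ?thesis by (simp add: mult.commute)
qed

lemma ore_commutator_t_x: "ore_mult h ore_t ore_x = ore_mult h ore_x ore_t + [:h:]"
  using ore_relation[of h] by (simp add: ore_ext_def)


section \<open>Automorphisms are affine\<close>

lemma
  assumes "f \<in> carrier (ore_aut h)"
  shows ore_aut_bij: "bij f"
    and ore_aut_one: "f 1 = 1"
    and ore_aut_add: "f (P + Q) = f P + f Q"
    and ore_aut_mult: "f (ore_mult h P Q) = ore_mult h (f P) (f Q)"
    and ore_aut_smult: "f (smult [:c:] P) = smult [:c:] (f P)"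
    and ore_aut_zero: "f 0 = 0"
    and ore_aut_eq_0_iff: "f P = 0 \<longleftrightarrow> P = 0"
proof -
  show bij: "bij f" and "f 1 = 1" and "f (P + Q) = f P + f Q"
    and "f (ore_mult h P Q) = ore_mult h (f P) (f Q)"
    and "f (smult [:c:] P) = smult [:c:] (f P)"
    using assms by (auto simp: ore_aut_iff)
  show 0: "f 0 = 0"
    using assms unfolding ore_aut_iff by (metis smult_0_left pCons_0_0)
  show "f P = 0 \<longleftrightarrow> P = 0"
    using bij 0 by (metis bij_is_inj injD)
qed

lemma ore_aut_const:
  assumes "f \<in> carrier (ore_aut h)"
  shows "f [:[:a:]:] = [:[:a:]:]"
proof -
  have "[:[:a:]:] = smult [:a:] 1"
    by (simp add: one_pCons)
  then show ?thesis
    by (metis ore_aut_smult[OF assms] ore_aut_one[OF assms])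
qed

text \<open>Horner's scheme: together with \<open>ore_aut_pCons\<close>, it computes
  \<open>f\<close> from the images of x and t by induction over coefficient lists.\<close>

lemma ore_aut_const_pCons:
  assumes "f \<in> carrier (ore_aut h)"
  shows "f [:pCons a q:] = [:[:a:]:] + ore_mult h (f ore_x) (f [:q:])"
proof -
  have "[:pCons a q:] = [:[:a:]:] + ore_mult h ore_x [:q:]"
    by (simp add: ore_x_def ore_mult_const)
  then show ?thesis
    by (simp add: ore_aut_add[OF assms] ore_aut_mult[OF assms] ore_aut_const[OF assms])
qed

lemma ore_aut_pCons:
  assumes "f \<in> carrier (ore_aut h)"
  shows "f (pCons p P) = f [:p:] + ore_mult h (f P) (f ore_t)"
proof -
  have "pCons p P = [:p:] + ore_mult h P ore_t"
    by (simp add: ore_mult_t_right)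
  then show ?thesis
    by (metis ore_aut_add[OF assms] ore_aut_mult[OF assms])
qed

section \<open>Invariance of h and its consequences for the images of x and t\<close>

lemma inv_ore_aut:
  assumes "f \<in> carrier (ore_aut h)"
  shows "inv_into UNIV f \<in> carrier (ore_aut h)"
proof -
  note bij = ore_aut_bij[OF assms]
  have f_inv [simp]: "f (inv_into UNIV f P) = P" for P
    using bij by (simp add: bij_is_surj surj_f_inv_f)
  have inv_eq: "inv_into UNIV f Q = P" if "f P = Q" for P Q
    using bij that by (metis bij_is_inj inv_f_f)
  show ?thesis
    unfolding ore_aut_iff
    by (auto intro!: inv_eq bij_imp_bij_inv bij
        simp: ore_aut_one[OF assms] ore_aut_add[OF assms] ore_aut_mult[OF assms] ore_aut_smult[OF assms])
qed

text \<open>The element \<open>h\<close> is the commutator of t and x, so its image is again a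
  commutator, and every commutator is divisible by \<open>h\<close>.\<close>

lemma dvd_ore_aut_h:
  assumes "f \<in> carrier (ore_aut h)"
  shows "[:h:] dvd f [:h:]"
proof -
  have "f [:h:] = ore_mult h (f ore_t) (f ore_x) - ore_mult h (f ore_x) (f ore_t)"
    using arg_cong[OF ore_commutator_t_x, of f h]
    by (simp add: ore_aut_add[OF assms] ore_aut_mult[OF assms])
  then show ?thesis
    using dvd_ore_commutator by simp
qed

lemma degree_ore_aut_h:
  assumes f: "f \<in> carrier (ore_aut h)" and "h \<noteq> 0"
  shows "degree (f [:h:]) = 0"
proof -
  obtain P where P: "f [:h:] = ore_mult h [:h:] P"
    using dvd_ore_aut_h[OF f] by (auto simp: dvd_def ore_mult_const)
  obtain Q where Q: "inv_into UNIV f [:h:] = ore_mult h [:h:] Q"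
    using dvd_ore_aut_h[OF inv_ore_aut[OF f]] by (auto simp: dvd_def ore_mult_const)
  have "[:h:] = f (inv_into UNIV f [:h:])"
    using ore_aut_bij[OF f] by (simp add: bij_is_surj surj_f_inv_f)
  also have "\<dots> = ore_mult h (ore_mult h [:h:] P) (f Q)"
    by (simp add: Q ore_aut_mult[OF f] P)
  \<comment> \<open>The divisibility for \<open>f\<close> and for its inverse combine to h = (h P)
    f(Q). Since \<open>h\<close> has degree 0 in t, additivity of degrees forces both factors to
    have degree 0, and the first one is f(h).\<close>
  finally have *: "[:h:] = ore_mult h (ore_mult h [:h:] P) (f Q)" .
  have nz: "ore_mult h [:h:] P \<noteq> 0" "f Q \<noteq> 0"
    using * \<open>h \<noteq> 0\<close> by auto
  have "degree (ore_mult h [:h:] P) + degree (f Q) = 0"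
    using ore_mult_degree[OF nz, of h] * by (metis degree_pCons_0)
  then show ?thesis by (simp add: P)
qed

text \<open>Positivity of the degree of f(x) keeps each Horner step dominated by its product term;
  the scalar added to it has degree 0.\<close>

lemma degree_ore_aut_const:
  assumes f: "f \<in> carrier (ore_aut h)" and pos: "degree (f ore_x) > 0" and "q \<noteq> 0"
  shows "degree (f [:q:]) = degree q * degree (f ore_x)"
  using \<open>q \<noteq> 0\<close>
proof (induction q)
  case (pCons a q)
  show ?case
  proof (cases "q = 0")
    case True
    then show ?thesis by (simp add: ore_aut_const[OF f])
  next
    case False
    have nz: "f ore_x \<noteq> 0" "f [:q:] \<noteq> 0"
      using False by (auto simp: ore_aut_eq_0_iff[OF f] ore_x_def)
    have deg: "degree (ore_mult h (f ore_x) (f [:q:])) = degree (f ore_x) + degree q * degree (f ore_x)"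
      using ore_mult_degree[OF nz, of h] pCons.IH[OF False] by simp
    have "degree (f [:pCons a q:]) = degree (ore_mult h (f ore_x) (f [:q:]))"
      unfolding ore_aut_const_pCons[OF f] by (rule degree_add_eq_right) (use deg pos in simp)
    with deg False show ?thesis by simp
  qed
qed simp

lemma ore_aut_x_const:
  assumes f: "f \<in> carrier (ore_aut h)" and "degree h > 0"
  obtains p where "f ore_x = [:p:]" and "\<And>q. f [:q:] = [:pcompose q p:]"
proof -
  have "degree (f ore_x) = 0"
  proof (rule ccontr)
    assume "degree (f ore_x) \<noteq> 0"
    then have "degree (f [:h:]) = degree h * degree (f ore_x)"
      using \<open>degree h > 0\<close> by (intro degree_ore_aut_const[OF f]) auto
    moreover have "degree (f [:h:]) = 0"
      using \<open>degree h > 0\<close> by (intro degree_ore_aut_h[OF f]) auto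
    ultimately show False
      using \<open>degree (f ore_x) \<noteq> 0\<close> \<open>degree h > 0\<close> by simp
  qed
  then obtain p where p: "f ore_x = [:p:]"
    by (rule degree_eq_zeroE)
  have "f [:q:] = [:pcompose q p:]" for q
    by (induction q) (simp_all add: ore_aut_zero[OF f] ore_aut_const_pCons[OF f] p ore_mult_const pcompose_pCons)
  with p show thesis by (rule that)
qed

text \<open>Both \<open>f\<close> and its inverse send x into k[x]. The two polynomials compose to
  x, so their degrees multiply to 1.\<close>

lemma ore_aut_x_linear:
  assumes f: "f \<in> carrier (ore_aut h)" and "degree h > 0"
  obtains a b where "a \<noteq> 0" and "\<And>q. f [:q:] = [:pcompose q [:b, a:]:]"
proof -
  obtain p where p: "\<And>q. f [:q:] = [:pcompose q p:]"
    using ore_aut_x_const[OF assms] by metis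
  obtain p' where p': "inv_into UNIV f ore_x = [:p':]"
    using ore_aut_x_const[OF inv_ore_aut[OF f] assms(2)] by metis
  have "ore_x = f (inv_into UNIV f ore_x)"
    using ore_aut_bij[OF f] by (simp add: bij_is_surj surj_f_inv_f)
  then have "pcompose p' p = [:0, 1:]"
    unfolding p' p by (simp add: ore_x_def)
  then have "degree p' * degree p = 1"
    by (metis degree_pcompose degree_pCons_eq_if degree_1 one_pCons One_nat_def one_neq_zero)
  then have "degree p = 1" by simp
  then obtain b a where "p = [:b, a:]" "a \<noteq> 0"
    by (metis degree1_coeffs)
  with p that show thesis by metis
qed

text \<open>Since \<open>f\<close> keeps k[x] in degree 0, it multiplies every degree in t by that
  of f(t). As t lies in the image, this factor divides 1.\<close>

lemma ore_aut_t_linear: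
  assumes f: "f \<in> carrier (ore_aut h)" and "degree h > 0"
  shows "degree (f ore_t) = 1"
proof -
  obtain p where p: "\<And>q. f [:q:] = [:pcompose q p:]"
    using ore_aut_x_const[OF assms] by metis
  have t_nz: "f ore_t \<noteq> 0"
    by (simp add: ore_aut_eq_0_iff[OF f] ore_t_def)
  have deg: "degree (f P) = degree P * degree (f ore_t)" for P
  proof (induction P)
    case (pCons c P)
    show ?case
    proof (cases "P = 0")
      case False
      have nz: "f P \<noteq> 0" using False by (simp add: ore_aut_eq_0_iff[OF f])
      \<comment> \<open>The summand from k[x] changes only the constant coefficient in t, and the
        degree of \<open>pCons c' P'\<close> depends on \<open>P'\<close> alone. This covers a
        product of degree 0 as well.\<close>
      have "degree (f (pCons c P)) = degree (ore_mult h (f P) (f ore_t))"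
      proof (cases "ore_mult h (f P) (f ore_t)" rule: pCons_cases)
        case (pCons c' P')
        then show ?thesis
          by (simp add: ore_aut_pCons[OF f, of c] p)
      qed
      also have "\<dots> = degree (pCons c P) * degree (f ore_t)"
        using ore_mult_degree[OF nz t_nz, of h] pCons.IH False by simp
      finally show ?thesis .
    qed (simp add: p)
  qed (simp add: ore_aut_zero[OF f])
  obtain P where "f P = ore_t"
    using ore_aut_bij[OF f] by (metis bij_pointE)
  then have "degree P * degree (f ore_t) = 1"
    using deg[of P] by (simp add: ore_t_def)
  then show ?thesis by simp
qed

text \<open>With no term of degree N-1 in \<open>h\<close>, everything below the leading monomial
  has degree less than N-1 and cannot contribute; the binomial theorem for (a x + b)^N gives the
  rest. In characteristic zero the formula detects whether \<open>b\<close> vanishes.\<close>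

lemma coeff_pcompose_affine_pred_degree:
  fixes h :: "'a::field poly"
  assumes "degree h > 0" and "coeff h (degree h - 1) = 0"
  shows "coeff (pcompose h [:b, a:]) (degree h - 1) =
    lead_coeff h * of_nat (degree h) * a ^ (degree h - 1) * b"
proof -
  define N where "N = degree h"
  define g where "g = h - monom (lead_coeff h) N"
  have "N > 0" using assms by (simp add: N_def)
  have g0: "coeff g i = 0" if "i \<ge> N - 1" for i
  proof -
    have "i = N - 1 \<or> i = N \<or> i > N" using that by linarith
    then show ?thesis
      using assms \<open>N > 0\<close> by (auto simp: g_def N_def coeff_eq_0)
  qed
  have "coeff (pcompose g [:b, a:]) (N - 1) = 0"
  proof (cases "g = 0")
    case False
    then have "degree g < N - 1"
      using g0[of "degree g"] by (metis leading_coeff_0_iff not_le)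
    moreover have "degree (pcompose g [:b, a:]) \<le> degree g * 1"
      by (rule order_trans[OF degree_pcompose_le]) simp
    ultimately show ?thesis by (simp add: coeff_eq_0)
  qed simp
  moreover have pow: "pcompose ([:0, 1:] ^ n) [:b, a:] = [:b, a:] ^ n" for n
    by (induction n) (simp_all add: pcompose_1 pcompose_mult pcompose_pCons)
  have "pcompose h [:b, a:] = smult (lead_coeff h) ([:b, a:] ^ N) + pcompose g [:b, a:]"
  proof -
    have "h = smult (lead_coeff h) ([:0, 1:] ^ N) + g"
      by (simp add: g_def monom_altdef)
    then have "pcompose h [:b, a:] = pcompose (smult (lead_coeff h) ([:0, 1:] ^ N) + g) [:b, a:]"
      by simp
    also have "\<dots> = smult (lead_coeff h) ([:b, a:] ^ N) + pcompose g [:b, a:]"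
      by (simp add: pcompose_add pcompose_smult pow)
    finally show ?thesis .
  qed
  moreover have "N choose (N - 1) = N"
    using \<open>N > 0\<close> by (cases N) simp_all
  ultimately show ?thesis
    using \<open>N > 0\<close> by (simp add: coeff_linear_poly_power flip: N_def)
qed

text \<open>These maps contain both families: a = 1 gives the sigma automorphisms, r = 0 the tau
  automorphisms. The exponent is a natural number and agrees with the \<open>powi\<close> of
  \<open>ore_tau\<close> once \<open>h\<close> has positive degree.\<close>

definition ore_lin :: "'a::field poly \<Rightarrow> 'a \<Rightarrow> 'a poly \<Rightarrow> 'a poly poly \<Rightarrow> 'a poly poly" where
  "ore_lin h a r = ore_subst h a (a ^ (degree h - 1)) r"

lemma ore_lin_x: "ore_lin h a r ore_x = smult [:a:] ore_x"
  by (simp add: ore_lin_def ore_subst_x)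

lemma ore_lin_t: "ore_lin h a r ore_t = smult [:a ^ (degree h - 1):] ore_t + [:r:]"
  by (simp add: ore_lin_def ore_subst_t)

lemma ore_lin_aut:
  assumes "degree h > 0" and "a \<in> tau_domain h"
  shows "ore_lin h a r \<in> carrier (ore_aut h)"
proof -
  have "a ^ (degree h - 1) * a = a ^ degree h"
    using assms by (metis power_minus_mult)
  then show ?thesis
    using assms unfolding ore_lin_def by (intro ore_subst_aut) (auto simp: tau_domain_def)
qed

lemma ore_aut_eq_ore_lin:
  fixes h :: "'a::field_char_0 poly"
  assumes f: "f \<in> carrier (ore_aut h)" and pos: "degree h > 0"
    and h0: "coeff h (degree h - 1) = 0"
  obtains a r where "a \<in> tau_domain h" and "f = ore_lin h a r"
proof -
  have "h \<noteq> 0" using pos by auto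
  obtain a b where a: "a \<noteq> 0" and f_const: "\<And>q. f [:q:] = [:pcompose q [:b, a:]:]"
    using ore_aut_x_linear[OF f pos] by metis
  obtain r s where rs: "f ore_t = [:r, s:]" and "s \<noteq> 0"
    using ore_aut_t_linear[OF f pos] by (metis degree1_coeffs)
  have fx: "f ore_x = [:[:b, a:]:]"
    by (simp add: ore_x_def f_const pcompose_pCons)
  \<comment> \<open>This is the image under \<open>f\<close> of the relation t x = x t + h.\<close>
  have "[:pcompose h [:b, a:]:] + ore_mult h [:[:b, a:]:] [:r, s:] = ore_mult h [:r, s:] [:[:b, a:]:]"
    using arg_cong[OF ore_commutator_t_x, of f h]
    by (simp add: ore_aut_add[OF f] ore_aut_mult[OF f] fx rs f_const add.commute)
  \<comment> \<open>Moving r + s t past a x + b produces only the derivation term s h a.\<close>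
  then have comp: "pcompose h [:b, a:] = smult a (s * h)"
    by (simp add: ore_mult_pCons ore_t_mult_pCons pderiv_pCons algebra_simps)
  have "degree (pcompose h [:b, a:]) = degree h"
    using a by (simp add: degree_pcompose)
  moreover have "degree (smult a (s * h)) = degree s + degree h"
    using a \<open>s \<noteq> 0\<close> \<open>h \<noteq> 0\<close> by (simp add: degree_mult_eq)
  ultimately have "degree s = 0"
    by (simp add: comp)
  then obtain c where c: "s = [:c:]"
    by (rule degree_eq_zeroE)
  with comp have comp: "pcompose h [:b, a:] = smult (a * c) h"
    by simp
  \<comment> \<open>The right side of \<open>comp\<close> has no term of degree N-1, hence neither
    has h(a x + b).\<close>
  have "lead_coeff h * of_nat (degree h) * a ^ (degree h - 1) * b = 0"
    using coeff_pcompose_affine_pred_degree[OF pos h0, of b a] h0 by (simp add: comp)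
  with a pos have b: "b = 0"
    by auto
  \<comment> \<open>Leading coefficients now determine the factor \<open>c\<close> of t in terms of
    \<open>a\<close>.\<close>
  have "lead_coeff (pcompose h [:b, a:]) = lead_coeff h * a ^ degree h"
    using a by (subst lead_coeff_comp) auto
  moreover have "lead_coeff (pcompose h [:b, a:]) = (a * c) * lead_coeff h"
    unfolding comp by (rule lead_coeff_smult)
  ultimately have ac: "a * c = a ^ degree h"
    using pos by auto
  then have "a * c = a * a ^ (degree h - 1)"
    using pos by (metis power_minus_mult mult.commute)
  with a have c_eq: "c = a ^ (degree h - 1)"
    by simp
  have dom: "a \<in> tau_domain h"
    using a comp ac b by (simp add: tau_domain_def)
  have "f = ore_lin h a r"
    by (rule ore_aut_eqI[OF f ore_lin_aut[OF pos dom]])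
      (simp_all add: fx b rs c c_eq ore_lin_x ore_lin_t, simp_all add: ore_x_def ore_t_def)
  with dom show thesis by (rule that)
qed


section \<open>The group structure\<close>

lemma group_ore_aut: "group (ore_aut h)"
proof (rule groupI)
  fix f assume f: "f \<in> carrier (ore_aut h)"
  then have "inv_into UNIV f \<circ> f = id"
    using ore_aut_bij by (metis bij_is_inj inv_o_cancel)
  then show "\<exists>g\<in>carrier (ore_aut h). g \<otimes>\<^bsub>ore_aut h\<^esub> f = \<one>\<^bsub>ore_aut h\<^esub>"
    using inv_ore_aut[OF f] by (auto simp: ore_aut_def)
next
  fix f g assume "f \<in> carrier (ore_aut h)" "g \<in> carrier (ore_aut h)"
  then have "f \<circ> g \<in> carrier (ore_aut h)"
    unfolding ore_aut_iff by (auto intro: bij_comp)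
  then show "f \<otimes>\<^bsub>ore_aut h\<^esub> g \<in> carrier (ore_aut h)"
    by (simp add: ore_aut_def)
next
  have "id \<in> carrier (ore_aut h)"
    unfolding ore_aut_iff by auto
  then show "\<one>\<^bsub>ore_aut h\<^esub> \<in> carrier (ore_aut h)"
    by (simp add: ore_aut_def)
qed (auto simp: ore_aut_def)

section \<open>Calculus of the maps \<open>ore_lin\<close>\<close>

lemma ore_aut_mult_eq: "f \<otimes>\<^bsub>ore_aut h\<^esub> g = f \<circ> g"
  and ore_aut_one_eq: "\<one>\<^bsub>ore_aut h\<^esub> = id"
  by (simp_all add: ore_aut_def)

lemma one_in_tau_domain: "1 \<in> tau_domain h"
  by (simp add: tau_domain_def)

lemma mult_in_tau_domain:
  assumes "a \<in> tau_domain h" "b \<in> tau_domain h"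
  shows "a * b \<in> tau_domain h"
proof -
  have "pcompose h [:0, a * b:] = pcompose (pcompose h [:0, a:]) [:0, b:]"
    by (simp add: pcompose_assoc[symmetric] pcompose_pCons mult.commute)
  also have "\<dots> = smult ((a * b) ^ degree h) h"
    using assms by (simp add: tau_domain_def pcompose_smult power_mult_distrib)
  finally show ?thesis
    using assms by (simp add: tau_domain_def)
qed

lemma inverse_in_tau_domain:
  assumes "a \<in> tau_domain h"
  shows "inverse a \<in> tau_domain h"
proof -
  have a: "a \<noteq> 0" and h: "pcompose h [:0, a:] = smult (a ^ degree h) h"
    using assms by (auto simp: tau_domain_def)
  have "h = pcompose (pcompose h [:0, a:]) [:0, inverse a:]"
    using a by (simp add: pcompose_assoc[symmetric] pcompose_pCons)
  also have "\<dots> = smult (a ^ degree h) (pcompose h [:0, inverse a:])"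
    by (simp add: h pcompose_smult)
  finally have "smult (inverse a ^ degree h) h =
      smult (inverse a ^ degree h) (smult (a ^ degree h) (pcompose h [:0, inverse a:]))"
    by simp
  also have "\<dots> = pcompose h [:0, inverse a:]"
    using a by (simp flip: power_mult_distrib)
  finally show ?thesis
    using a by (simp add: tau_domain_def)
qed

text \<open>The outer map sends b^(N-1) t + q(x) to b^(N-1) (a^(N-1) t + r) + q(a x). With this law,
  computations in the automorphism group become arithmetic with pairs (a, r).\<close>

lemma ore_lin_comp:
  assumes "degree h > 0" "a \<in> tau_domain h" "b \<in> tau_domain h"
  shows "ore_lin h a r \<circ> ore_lin h b q =
    ore_lin h (a * b) (smult (b ^ (degree h - 1)) r + pcompose q [:0, a:])"
proof (rule ore_aut_eqI)
  note aut = ore_lin_aut[OF assms(1)]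
  show "ore_lin h a r \<circ> ore_lin h b q \<in> carrier (ore_aut h)"
    using group.is_monoid[OF group_ore_aut, of h] aut[OF assms(2)] aut[OF assms(3)]
    by (metis monoid.m_closed ore_aut_mult_eq)
  show "ore_lin h (a * b) (smult (b ^ (degree h - 1)) r + pcompose q [:0, a:]) \<in> carrier (ore_aut h)"
    by (rule aut[OF mult_in_tau_domain[OF assms(2,3)]])
  show "(ore_lin h a r \<circ> ore_lin h b q) ore_x =
      ore_lin h (a * b) (smult (b ^ (degree h - 1)) r + pcompose q [:0, a:]) ore_x"
    by (simp add: ore_lin_x ore_aut_smult[OF aut[OF assms(2)]] mult.commute)
  have "ore_lin h a r [:q:] = [:pcompose q [:0, a:]:]"
    by (simp add: ore_lin_def ore_subst_const)
  then show "(ore_lin h a r \<circ> ore_lin h b q) ore_t =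
      ore_lin h (a * b) (smult (b ^ (degree h - 1)) r + pcompose q [:0, a:]) ore_t"
    by (simp add: ore_lin_t ore_aut_smult[OF aut[OF assms(2)]] ore_aut_add[OF aut[OF assms(2)]]
        smult_add_right power_mult_distrib mult.commute)
qed

lemma ore_lin_eq_iff: "ore_lin h a r = ore_lin h b q \<longleftrightarrow> a = b \<and> r = q"
proof
  assume eq: "ore_lin h a r = ore_lin h b q"
  have "a = b"
    using fun_cong[OF eq, of ore_x] by (simp add: ore_lin_x) (simp add: ore_x_def)
  moreover have "r = q"
    using fun_cong[OF eq, of ore_t] \<open>a = b\<close> by (simp add: ore_lin_t)
  ultimately show "a = b \<and> r = q" by simp
qed simp

lemma ore_lin_1_0: "ore_lin h 1 0 = id"
proof (rule ore_aut_eqI)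
  show "ore_lin h 1 0 \<in> carrier (ore_aut h)"
    unfolding ore_lin_def by (rule ore_subst_aut) auto
  show "id \<in> carrier (ore_aut h)"
    unfolding ore_aut_iff by auto
qed (simp_all add: ore_lin_x ore_lin_t)

lemma ore_sigma_eq: "ore_sigma h r = ore_lin h 1 r"
  unfolding ore_sigma_def
proof (rule the1_equality[OF ore_sigma_ex1])
  have "ore_lin h 1 r \<in> carrier (ore_aut h)"
    unfolding ore_lin_def by (rule ore_subst_aut) auto
  then show "ore_lin h 1 r \<in> carrier (ore_aut h) \<and> ore_lin h 1 r ore_x = ore_x \<and>
      ore_lin h 1 r ore_t = ore_t + [:r:]"
    by (simp add: ore_lin_x ore_lin_t)
qed

lemma ore_tau_eq:
  assumes "degree h > 0" and "a \<in> tau_domain h"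
  shows "ore_tau h a = ore_lin h a 0"
  unfolding ore_tau_def
proof (rule the1_equality[OF ore_tau_ex1[OF assms(2)]])
  have "a powi (int (degree h) - 1) = a ^ (degree h - 1)"
    using assms(1) by (simp add: power_int_def nat_diff_distrib)
  then show "ore_lin h a 0 \<in> carrier (ore_aut h) \<and> ore_lin h a 0 ore_x = smult [:a:] ore_x \<and>
      ore_lin h a 0 ore_t = smult [:a powi (int (degree h) - 1):] ore_t"
    using ore_lin_aut[OF assms] by (simp add: ore_lin_x ore_lin_t)
qed

section \<open>Assembling the semidirect product\<close>

lemma group_mult_group_of: "group (mult_group_of TYPE('a::field))"
proof (rule groupI)
  fix a assume "a \<in> carrier (mult_group_of TYPE('a))"
  then show "\<exists>b\<in>carrier (mult_group_of TYPE('a)).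
      b \<otimes>\<^bsub>mult_group_of TYPE('a)\<^esub> a = \<one>\<^bsub>mult_group_of TYPE('a)\<^esub>"
    by (intro bexI[of _ "inverse a"]) (auto simp: mult_group_of_def)
qed (auto simp: mult_group_of_def)

lemma subgroup_tau_domain:
  fixes h :: "'a::field poly"
  shows "subgroup (tau_domain h) (mult_group_of TYPE('a))"
proof -
  interpret group "mult_group_of TYPE('a)" by (rule group_mult_group_of)
  show ?thesis
  proof (rule subgroupI)
    fix a assume a: "a \<in> tau_domain h"
    then have "inv\<^bsub>mult_group_of TYPE('a)\<^esub> a = inverse a"
      by (intro inv_equality) (auto simp: mult_group_of_def tau_domain_def)
    with a show "inv\<^bsub>mult_group_of TYPE('a)\<^esub> a \<in> tau_domain h"
      by (simp add: inverse_in_tau_domain)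
  next
    fix a b assume "a \<in> tau_domain h" "b \<in> tau_domain h"
    then show "a \<otimes>\<^bsub>mult_group_of TYPE('a)\<^esub> b \<in> tau_domain h"
      by (simp add: mult_in_tau_domain mult_group_of_def)
  next
    show "tau_domain h \<noteq> {}"
      using one_in_tau_domain[of h] by auto
  qed (auto simp: mult_group_of_def tau_domain_def)
qed

theorem aut_eq_semidirect_tau_domain:
  fixes h :: "'a::field_char_0 poly"
  assumes pos: "degree h > 0" and h0: "coeff h (degree h - 1) = 0"
  shows "aut_eq_semidirect h (tau_domain h)"
proof -
  interpret group "ore_aut h" by (rule group_ore_aut)
  note aut = ore_lin_aut[OF pos] and comp = ore_lin_comp[OF pos]
  note one = one_in_tau_domain[of h]
  have sigma: "ore_sigma h = ore_lin h 1"
    by (rule ext) (rule ore_sigma_eq)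
  have tau: "ore_tau h a = ore_lin h a 0" if "a \<in> tau_domain h" for a
    using ore_tau_eq[OF pos that] .
  have tau_img: "ore_tau h ` tau_domain h = (\<lambda>a. ore_lin h a 0) ` tau_domain h"
    using tau by (intro image_cong) auto
  \<comment> \<open>Composing sigma_q with tau_a yields the pair (a, a^(N-1) q), so q must be r
    divided by a^(N-1).\<close>
  have sigma_tau: "ore_lin h a r = ore_lin h 1 (smult (inverse (a ^ (degree h - 1))) r) \<circ> ore_lin h a 0"
    if "a \<in> tau_domain h" for a r
    using that by (simp add: comp one tau_domain_def)
  have carrier: "f \<in> carrier (ore_aut h) \<longleftrightarrow> (\<exists>a\<in>tau_domain h. \<exists>r. f = ore_lin h a r)" for f
    using ore_aut_eq_ore_lin[OF _ pos h0] aut by metis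
  have inv_lin: "inv\<^bsub>ore_aut h\<^esub> (ore_lin h a r) = ore_lin h b q"
    if "a \<in> tau_domain h" "b \<in> tau_domain h"
      "ore_lin h b q \<circ> ore_lin h a r = id" for a b r q
    using that aut by (intro inv_equality) (auto simp: ore_aut_mult_eq ore_aut_one_eq)
  have inv_sigma: "inv\<^bsub>ore_aut h\<^esub> (ore_lin h 1 r) = ore_lin h 1 (- r)" for r
    by (rule inv_lin) (auto simp: comp one ore_lin_1_0)
  have inv_tau: "inv\<^bsub>ore_aut h\<^esub> (ore_lin h a 0) = ore_lin h (inverse a) 0"
    if "a \<in> tau_domain h" for a
    using that inverse_in_tau_domain[OF that]
    by (intro inv_lin) (auto simp: comp ore_lin_1_0 tau_domain_def)
  have subN: "subgroup (range (ore_sigma h)) (ore_aut h)"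
    by (rule subgroupI)
      (auto simp: sigma inv_sigma aut one ore_aut_mult_eq comp)
  have subH: "subgroup (ore_tau h ` tau_domain h) (ore_aut h)"
    unfolding tau_img
    by (rule subgroupI)
      (use one in \<open>auto simp: inv_tau aut ore_aut_mult_eq comp mult_in_tau_domain
        intro!: imageI inverse_in_tau_domain\<close>)
  have conj: "f \<otimes>\<^bsub>ore_aut h\<^esub> g \<otimes>\<^bsub>ore_aut h\<^esub> inv\<^bsub>ore_aut h\<^esub> f \<in> range (ore_sigma h)"
    if f: "f \<in> carrier (ore_aut h)" and g: "g \<in> range (ore_sigma h)" for f g
  proof -
    obtain a r where a: "a \<in> tau_domain h" and fa: "f = ore_lin h a r"
      using f carrier by auto
    obtain q where q: "g = ore_lin h 1 q"
      using g by (auto simp: sigma)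
    \<comment> \<open>Chosen to solve f sigma_q = sigma_q' f: comparing second components gives
      a^(N-1) q' = q(a x).\<close>
    define q' where "q' = smult (inverse (a ^ (degree h - 1))) (pcompose q [:0, a:])"
    have "f \<otimes>\<^bsub>ore_aut h\<^esub> g = ore_lin h 1 q' \<otimes>\<^bsub>ore_aut h\<^esub> f"
      using a by (simp add: fa q ore_aut_mult_eq comp one q'_def tau_domain_def add.commute)
    then have "f \<otimes>\<^bsub>ore_aut h\<^esub> g \<otimes>\<^bsub>ore_aut h\<^esub> inv\<^bsub>ore_aut h\<^esub> f = ore_lin h 1 q'"
      using f aut[OF one, of q'] by (simp add: m_assoc)
    then show ?thesis by (simp add: sigma)
  qed
  have normal: "range (ore_sigma h) \<lhd> ore_aut h"
    unfolding normal_inv_iff using subN conj by blast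
  \<comment> \<open>Writing the identity as \<open>ore_lin h 1 0\<close> lets
    \<open>ore_lin_eq_iff\<close> compare parameters.\<close>
  have inter: "range (ore_sigma h) \<inter> ore_tau h ` tau_domain h = {\<one>\<^bsub>ore_aut h\<^esub>}"
    unfolding tau_img using one by (auto simp: sigma ore_lin_eq_iff ore_aut_one_eq simp flip: ore_lin_1_0[of h])
  have prod: "range (ore_sigma h) <#>\<^bsub>ore_aut h\<^esub> ore_tau h ` tau_domain h = carrier (ore_aut h)"
  proof
    show "range (ore_sigma h) <#>\<^bsub>ore_aut h\<^esub> ore_tau h ` tau_domain h \<subseteq> carrier (ore_aut h)"
      using subgroup.subset[OF subN] subgroup.subset[OF subH] by (rule set_mult_closed)
    show "carrier (ore_aut h) \<subseteq> range (ore_sigma h) <#>\<^bsub>ore_aut h\<^esub> ore_tau h ` tau_domain h"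
    proof
      fix f assume "f \<in> carrier (ore_aut h)"
      then obtain a r where a: "a \<in> tau_domain h" and f: "f = ore_lin h a r"
        using carrier by auto
      define q where "q = smult (inverse (a ^ (degree h - 1))) r"
      have "f = ore_lin h 1 q \<otimes>\<^bsub>ore_aut h\<^esub> ore_lin h a 0"
        unfolding f q_def ore_aut_mult_eq by (rule sigma_tau[OF a])
      moreover have "ore_lin h 1 q \<in> range (ore_sigma h)"
        by (simp add: sigma)
      moreover have "ore_lin h a 0 \<in> ore_tau h ` tau_domain h"
        using a by (simp add: tau_img)
      ultimately show "f \<in> range (ore_sigma h) <#>\<^bsub>ore_aut h\<^esub> ore_tau h ` tau_domain h"
        unfolding set_mult_def by blast
    qed
  qed
  have iso_sigma: "ore_sigma h \<in>
      iso (add_group_of TYPE('a poly)) (ore_aut h\<lparr>carrier := range (ore_sigma h)\<rparr>)"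
    by (rule isoI)
      (auto simp: hom_def add_group_of_def sigma ore_aut_mult_eq comp one bij_betw_def inj_on_def ore_lin_eq_iff)
  have iso_tau: "ore_tau h \<in> iso (mult_group_of TYPE('a)\<lparr>carrier := tau_domain h\<rparr>)
      (ore_aut h\<lparr>carrier := ore_tau h ` tau_domain h\<rparr>)"
    by (rule isoI)
      (auto simp: hom_def mult_group_of_def ore_aut_mult_eq comp tau mult_in_tau_domain
        bij_betw_def inj_on_def ore_lin_eq_iff)
  have "bij_betw (\<lambda>(r, a). ore_sigma h r \<circ> ore_tau h a) (UNIV \<times> tau_domain h) (carrier (ore_aut h))"
    unfolding bij_betw_def
  proof
    show "inj_on (\<lambda>(r, a). ore_sigma h r \<circ> ore_tau h a) (UNIV \<times> tau_domain h)"
    proof (rule inj_onI, clarify)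
      fix r a q b
      assume a: "a \<in> tau_domain h" and b: "b \<in> tau_domain h"
        and "ore_sigma h r \<circ> ore_tau h a = ore_sigma h q \<circ> ore_tau h b"
      then have "a = b" "smult (a ^ (degree h - 1)) r = smult (a ^ (degree h - 1)) q"
        by (auto simp: sigma tau comp one ore_lin_eq_iff)
      moreover have "a ^ (degree h - 1) \<noteq> 0"
        using a by (simp add: tau_domain_def)
      ultimately show "r = q \<and> a = b"
        by (auto simp: poly_eq_iff)
    qed
    show "(\<lambda>(r, a). ore_sigma h r \<circ> ore_tau h a) ` (UNIV \<times> tau_domain h) = carrier (ore_aut h)"
    proof
      show "(\<lambda>(r, a). ore_sigma h r \<circ> ore_tau h a) ` (UNIV \<times> tau_domain h) \<subseteq> carrier (ore_aut h)"
        using aut mult_in_tau_domain[OF one] by (auto simp: sigma tau comp one)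
      show "carrier (ore_aut h) \<subseteq> (\<lambda>(r, a). ore_sigma h r \<circ> ore_tau h a) ` (UNIV \<times> tau_domain h)"
      proof
        fix f assume "f \<in> carrier (ore_aut h)"
        then obtain a q where "a \<in> tau_domain h" "f = ore_lin h 1 q \<circ> ore_lin h a 0"
          using carrier sigma_tau by metis
        then show "f \<in> (\<lambda>(r, a). ore_sigma h r \<circ> ore_tau h a) ` (UNIV \<times> tau_domain h)"
          by (intro image_eqI[of _ _ "(q, a)"]) (auto simp: sigma tau)
      qed
    qed
  qed
  with subgroup_tau_domain normal subH inter prod iso_sigma iso_tau show ?thesis
    unfolding aut_eq_semidirect_def internal_semidirect_def by blast
qed


section \<open>Roots of unity\<close>

text \<open>Absorbs the case split: a^0 = 1 is no condition, and for positive n the equation a^n = 1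
  already excludes 0.\<close>

lemma root_group_iff: "a \<in> root_group n \<longleftrightarrow> a \<noteq> 0 \<and> a ^ n = 1"
  by (auto simp: root_group_def zero_power)

lemma root_group_gcd: "root_group (gcd m n) = (root_group m \<inter> root_group n :: 'a::field set)"
proof
  show "root_group (gcd m n) \<subseteq> (root_group m \<inter> root_group n :: 'a set)"
  proof
    fix a :: 'a assume "a \<in> root_group (gcd m n)"
    then have a: "a \<noteq> 0" "a ^ gcd m n = 1"
      by (auto simp: root_group_iff)
    then have "a ^ k = 1" if "gcd m n dvd k" for k
      using that by (auto simp: power_mult)
    with a(1) show "a \<in> root_group m \<inter> root_group n"
      by (simp add: root_group_iff)
  qed
  show "root_group m \<inter> root_group n \<subseteq> (root_group (gcd m n) :: 'a set)"
  proof (cases "m = 0")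
    case False
    \<comment> \<open>Bezout over the naturals has this one-sided form for nonzero \<open>m\<close>;
      for m = 0 the gcd is \<open>n\<close> and the inclusion is immediate.\<close>
    then obtain x y where xy: "m * x = n * y + gcd m n"
      using bezout_nat by blast
    show ?thesis
    proof
      fix a :: 'a assume "a \<in> root_group m \<inter> root_group n"
      then have a: "a \<noteq> 0" "a ^ m = 1" "a ^ n = 1"
        by (auto simp: root_group_iff)
      have "a ^ (m * x) = a ^ (n * y) * a ^ gcd m n"
        by (simp add: xy power_add)
      with a show "a \<in> root_group (gcd m n)"
        by (simp add: root_group_iff power_mult)
    qed
  qed auto
qed

text \<open>The explicit set of nonzero elements accounts for empty \<open>S\<close>, where
  \<open>Gcd\<close> is 0 and the intersection alone would contain 0.\<close>

lemma root_group_Gcd: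
  assumes "finite S"
  shows "root_group (Gcd S) = {a. a \<noteq> 0} \<inter> (\<Inter>n\<in>S. root_group n)"
  using assms by (induction S) (auto simp: root_group_gcd, auto simp: root_group_iff)

text \<open>Comparing coefficients of x^i in h(a x) = a^N h(x) gives a^i c_i = a^N c_i, and a^i
  cancels for nonzero \<open>a\<close>.\<close>

lemma tau_domain_eq_root_groups:
  fixes h :: "'a::field poly"
  assumes "h \<noteq> 0"
  shows "tau_domain h = (\<Inter>i\<in>poly_support h. root_group (degree h - i))"
proof -
  have nonzero: "a \<in> tau_domain h \<longleftrightarrow> (\<forall>i\<in>poly_support h. a \<in> root_group (degree h - i))"
    if a: "a \<noteq> 0" for a
  proof -
    have "a ^ i * coeff h i = a ^ degree h * coeff h i \<longleftrightarrow>
        (coeff h i \<noteq> 0 \<longrightarrow> a ^ (degree h - i) = 1)" for i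
    proof (cases "coeff h i = 0")
      case False
      then have "a ^ degree h = a ^ i * a ^ (degree h - i)"
        by (simp add: le_degree flip: power_add)
      with a False show ?thesis by auto
    qed simp
    then show ?thesis
      using a by (simp add: tau_domain_def poly_support_def root_group_iff poly_eq_iff
          coeff_pcompose_linear)
  qed
  have "0 \<notin> tau_domain h"
    by (simp add: tau_domain_def)
  \<comment> \<open>The support contains \<open>degree h\<close>, hence is nonempty, and no
    \<open>root_group\<close> contains 0.\<close>
  moreover have "\<not> (\<forall>i\<in>poly_support h. 0 \<in> root_group (degree h - i))"
    using assms by (auto simp: root_group_iff poly_support_def intro!: exI[of _ "degree h"])
  ultimately have "a \<in> tau_domain h \<longleftrightarrow> (\<forall>i\<in>poly_support h. a \<in> root_group (degree h - i))" for a
    using nonzero[of a] by (cases "a = 0") simp_all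
  then show ?thesis
    by auto
qed

theorem corollary15:
  fixes h :: "'a::{alg_closed_field, field_char_0} poly" and N :: nat
  assumes "degree h = N" and "N \<ge> 1"
    and "coeff h N = 1" and "coeff h (N - 1) = 0"
  shows "(h = monom 1 N \<longrightarrow> aut_eq_semidirect h {a. a \<noteq> 0}) \<and>
    (h \<noteq> monom 1 N \<longrightarrow>
       aut_eq_semidirect h (\<Inter>i\<in>poly_support h. root_group (N - i)) \<and>
       aut_eq_semidirect h (root_group (Gcd ((\<lambda>i. N - i) ` (poly_support h - {N})))))"
proof -
  have main: "aut_eq_semidirect h (tau_domain h)"
    using assms by (intro aut_eq_semidirect_tau_domain) auto
  have "h \<noteq> 0" using assms by auto
  have dom: "tau_domain h = (\<Inter>i\<in>poly_support h. root_group (N - i))"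
    using tau_domain_eq_root_groups[OF \<open>h \<noteq> 0\<close>] assms by simp
  have N: "N \<in> poly_support h"
    using assms by (simp add: poly_support_def)
  have "poly_support h \<subseteq> {..N}"
    using assms by (auto simp: poly_support_def le_degree)
  then have fin: "finite (poly_support h)"
    by (rule finite_subset) simp
  have "root_group (Gcd ((\<lambda>i. N - i) ` (poly_support h - {N}))) =
      {a. a \<noteq> 0} \<inter> (\<Inter>i\<in>poly_support h - {N}. root_group (N - i) :: 'a set)"
    using fin by (subst root_group_Gcd) auto
  \<comment> \<open>The nonvanishing condition is exactly the contribution of the index N, which is
    thereby put back into the support.\<close>
  also have "{a. a \<noteq> 0} = (root_group (N - N) :: 'a set)"
    by (simp add: root_group_def)
  also have "root_group (N - N) \<inter> (\<Inter>i\<in>poly_support h - {N}. root_group (N - i)) =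
      (\<Inter>i\<in>insert N (poly_support h - {N}). root_group (N - i) :: 'a set)"
    by (simp only: INT_insert)
  also have "\<dots> = tau_domain h"
    using N by (simp add: dom insert_absorb)
  finally have Gcd: "root_group (Gcd ((\<lambda>i. N - i) ` (poly_support h - {N}))) = tau_domain h" .
  have "tau_domain h = {a. a \<noteq> 0}" if "h = monom 1 N"
  proof -
    have "poly_support h = {N}"
      by (auto simp: that poly_support_def)
    then show ?thesis
      by (simp add: dom root_group_def)
  qed
  then show ?thesis
    using main Gcd dom by metis
qed

end
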